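(* Let $T,L,\omega_{\mathrm a},\omega_{\mathrm b}\in\mathbb{R}_{>0}$, $l,N_{\max}\in\mathbb{Z}_{>0}$, $\rho\in[0,\pi/L)$, and $\omega_{\mathrm c}:=\frac{2}{L}\tan\left(\frac{L}{2}\rho\right)>0$. Let $\Phi(s)$ be the linear-phase low-pass filter defined in the context from $T,L,\omega_{\mathrm a},l,N_{\max}$ (with $\mathcal N\neq\emptyset$ and $\kappa\ge 1$), let $$\Gamma(s)=\frac{\omega_{\mathrm c}L}{2}\,\frac{1+\Phi(s)}{1-\Phi(s)}\,\frac{\omega_{\mathrm b}}{s+\omega_{\mathrm b}},$$ and let $S(s):=\dfrac{1}{1+\Gamma(s)}$. Then $$\lim_{\varepsilon\to0^+}\int_{0}^{\infty}\ln|S(\varepsilon+j\omega)|\,d\omega=-\frac{\pi\,\omega_{\mathrm b}\,\omega_{\mathrm c}\,L}{4}.$$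
   Context: $j$ is the imaginary unit. The integral over $[0,\infty)$ is the improper integral $\lim_{R\to\infty}\int_0^R$. Definition of $\Phi$. Parameters: $T>0$ (sampling time), $L>0$ (period), $\omega_{\mathrm a}>0$ (cutoff frequency), $l\in\mathbb{Z}_{>0}$ (number of stages), $N_{\max}\in\mathbb{Z}_{>0}$ (maximum order). Put $c:=\frac12\left(\frac{T\omega_{\mathrm a}}{\pi}\right)^{1/l}$ and define recursively for $i=1,\dots,l$: $U_1:=T$, $U_i:=\pi/\omega_{i-1}$ for $i\ge2$; $\omega_i:=2c\pi/U_i$ for $i<l$, $\omega_l:=\omega_{\mathrm a}$. Put $\mathcal N:=\{n\in\mathbb{Z}_{>0}\mid n\le (L-T)/\sum_{i=1}^lU_i\}$ (assumed nonempty) and $N:=\min\{\max(\mathcal N),N_{\max}\}$. Put $\bar U_i:=\mathrm{round}(U_i/T)$, $\bar L:=\mathrm{round}(L/T)$ (rounding to the nearest integer), and $\kappa:=\bar L-N\sum_{i=1}^l\bar U_i$, assumed to satisfy $\kappa\ge1$. For integers $n$ let $$w(n,N):=0.42+0.5\cos(n\pi/N)+0.08\cos(2n\pi/N)\ \text{ if }|n|\le N,\qquad w(n,N):=0\ \text{ if }|n|>N,$$ $$h(n,\omega_i,U_i):=U_i\omega_i/\pi\ \text{ if }n=0,\qquad h(n,\omega_i,U_i):=\sin(nU_i\omega_i)/(n\pi)\ \text{ if }n\ne0,$$ $$\alpha_i(n):=w(n,N)\,h(n,\omega_i,U_i),\qquad \gamma_i:=\max_{\Omega\in[0,\pi]}\left|\alpha_i(0)+2\sum_{n=1}^N\alpha_i(n)\cos(n\Omega)\right|,$$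 $$\varphi_i(s):=\frac1{\gamma_i}\sum_{n=-N}^{N}\alpha_i(n)\,e^{(n-N)T\bar U_i s},\qquad \Phi(s):=e^{-\kappa Ts}\prod_{i=1}^l\varphi_i(s).$$ *)

theory Defs
  imports "HOL-Analysis.Analysis"
begin

definition stage_ratio :: "real \<Rightarrow> real \<Rightarrow> nat \<Rightarrow> real" where
  "stage_ratio T \<omega>\<^sub>a l = 1 / 2 * (T * \<omega>\<^sub>a / pi) powr (1 / real l)"

text \<open>
  Stages are numbered \<open>1, \<dots>, l\<close>; the values at index \<open>0\<close> and at indices above \<open>l\<close> are
  artefacts of totality and are never used.
\<close>

fun stage_period :: "real \<Rightarrow> real \<Rightarrow> nat \<Rightarrow> nat \<Rightarrow> real"
  and stage_cutoff :: "real \<Rightarrow> real \<Rightarrow> nat \<Rightarrow> nat \<Rightarrow> real"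
where
  "stage_period T \<omega>\<^sub>a l 0 = T"
| "stage_period T \<omega>\<^sub>a l (Suc 0) = T"
| "stage_period T \<omega>\<^sub>a l (Suc (Suc i)) = pi / stage_cutoff T \<omega>\<^sub>a l (Suc i)"
| "stage_cutoff T \<omega>\<^sub>a l i =
     (if i < l then 2 * stage_ratio T \<omega>\<^sub>a l * pi / stage_period T \<omega>\<^sub>a l i else \<omega>\<^sub>a)"

definition admissible_orders :: "real \<Rightarrow> real \<Rightarrow> real \<Rightarrow> nat \<Rightarrow> nat set" where
  "admissible_orders T L \<omega>\<^sub>a l =
     {n. 0 < n \<and> real n \<le> (L - T) / (\<Sum>i=1..l. stage_period T \<omega>\<^sub>a l i)}"

definition filter_order :: "real \<Rightarrow> real \<Rightarrow> real \<Rightarrow> nat \<Rightarrow> nat \<Rightarrow> nat" where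
  "filter_order T L \<omega>\<^sub>a l N\<^sub>m\<^sub>a\<^sub>x = min (Max (admissible_orders T L \<omega>\<^sub>a l)) N\<^sub>m\<^sub>a\<^sub>x"

definition stage_steps :: "real \<Rightarrow> real \<Rightarrow> nat \<Rightarrow> nat \<Rightarrow> int" where
  "stage_steps T \<omega>\<^sub>a l i = round (stage_period T \<omega>\<^sub>a l i / T)"

definition residual_delay :: "real \<Rightarrow> real \<Rightarrow> real \<Rightarrow> nat \<Rightarrow> nat \<Rightarrow> int" where
  "residual_delay T L \<omega>\<^sub>a l N\<^sub>m\<^sub>a\<^sub>x =
     round (L / T) - int (filter_order T L \<omega>\<^sub>a l N\<^sub>m\<^sub>a\<^sub>x) * (\<Sum>i=1..l. stage_steps T \<omega>\<^sub>a l i)"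

definition blackman_window :: "int \<Rightarrow> nat \<Rightarrow> real" where
  "blackman_window n N =
     (if \<bar>n\<bar> \<le> int N
      then 0.42 + 0.5 * cos (of_int n * pi / real N) + 0.08 * cos (2 * of_int n * pi / real N)
      else 0)"

definition ideal_response :: "int \<Rightarrow> real \<Rightarrow> real \<Rightarrow> real" where
  "ideal_response n \<omega> U =
     (if n = 0 then U * \<omega> / pi else sin (of_int n * U * \<omega>) / (of_int n * pi))"

definition stage_coeff :: "real \<Rightarrow> real \<Rightarrow> real \<Rightarrow> nat \<Rightarrow> nat \<Rightarrow> nat \<Rightarrow> int \<Rightarrow> real" where
  "stage_coeff T L \<omega>\<^sub>a l N\<^sub>m\<^sub>a\<^sub>x i n =
     blackman_window n (filter_order T L \<omega>\<^sub>a l N\<^sub>m\<^sub>a\<^sub>x) *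
     ideal_response n (stage_cutoff T \<omega>\<^sub>a l i) (stage_period T \<omega>\<^sub>a l i)"

definition stage_amplitude :: "real \<Rightarrow> real \<Rightarrow> real \<Rightarrow> nat \<Rightarrow> nat \<Rightarrow> nat \<Rightarrow> real \<Rightarrow> real" where
  "stage_amplitude T L \<omega>\<^sub>a l N\<^sub>m\<^sub>a\<^sub>x i \<Omega> =
     \<bar>stage_coeff T L \<omega>\<^sub>a l N\<^sub>m\<^sub>a\<^sub>x i 0 +
      2 * (\<Sum>n=1..filter_order T L \<omega>\<^sub>a l N\<^sub>m\<^sub>a\<^sub>x.
             stage_coeff T L \<omega>\<^sub>a l N\<^sub>m\<^sub>a\<^sub>x i (int n) * cos (real n * \<Omega>))\<bar>"

text \<open>The supremum below is a maximum, see \<open>stage_peak_is_max\<close>.\<close>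

definition stage_peak :: "real \<Rightarrow> real \<Rightarrow> real \<Rightarrow> nat \<Rightarrow> nat \<Rightarrow> nat \<Rightarrow> real" where
  "stage_peak T L \<omega>\<^sub>a l N\<^sub>m\<^sub>a\<^sub>x i = (SUP \<Omega>\<in>{0..pi}. stage_amplitude T L \<omega>\<^sub>a l N\<^sub>m\<^sub>a\<^sub>x i \<Omega>)"

definition stage_filter :: "real \<Rightarrow> real \<Rightarrow> real \<Rightarrow> nat \<Rightarrow> nat \<Rightarrow> nat \<Rightarrow> complex \<Rightarrow> complex" where
  "stage_filter T L \<omega>\<^sub>a l N\<^sub>m\<^sub>a\<^sub>x i s =
     (let N = int (filter_order T L \<omega>\<^sub>a l N\<^sub>m\<^sub>a\<^sub>x) in
      1 / of_real (stage_peak T L \<omega>\<^sub>a l N\<^sub>m\<^sub>a\<^sub>x i) *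
      (\<Sum>n=-N..N. of_real (stage_coeff T L \<omega>\<^sub>a l N\<^sub>m\<^sub>a\<^sub>x i n) *
         exp (of_int (n - N) * of_real T * of_int (stage_steps T \<omega>\<^sub>a l i) * s)))"

definition lowpass_filter :: "real \<Rightarrow> real \<Rightarrow> real \<Rightarrow> nat \<Rightarrow> nat \<Rightarrow> complex \<Rightarrow> complex" where
  "lowpass_filter T L \<omega>\<^sub>a l N\<^sub>m\<^sub>a\<^sub>x s =
     exp (- of_int (residual_delay T L \<omega>\<^sub>a l N\<^sub>m\<^sub>a\<^sub>x) * of_real T * s) *
     (\<Prod>i=1..l. stage_filter T L \<omega>\<^sub>a l N\<^sub>m\<^sub>a\<^sub>x i s)"

definition open_loop ::
  "real \<Rightarrow> real \<Rightarrow> real \<Rightarrow> real \<Rightarrow> real \<Rightarrow> nat \<Rightarrow> nat \<Rightarrow> complex \<Rightarrow> complex" where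
  "open_loop T L \<omega>\<^sub>a \<omega>\<^sub>b \<omega>\<^sub>c l N\<^sub>m\<^sub>a\<^sub>x s =
     of_real (\<omega>\<^sub>c * L / 2) *
     ((1 + lowpass_filter T L \<omega>\<^sub>a l N\<^sub>m\<^sub>a\<^sub>x s) / (1 - lowpass_filter T L \<omega>\<^sub>a l N\<^sub>m\<^sub>a\<^sub>x s)) *
     (of_real \<omega>\<^sub>b / (s + of_real \<omega>\<^sub>b))"

definition sensitivity ::
  "real \<Rightarrow> real \<Rightarrow> real \<Rightarrow> real \<Rightarrow> real \<Rightarrow> nat \<Rightarrow> nat \<Rightarrow> complex \<Rightarrow> complex" where
  "sensitivity T L \<omega>\<^sub>a \<omega>\<^sub>b \<omega>\<^sub>c l N\<^sub>m\<^sub>a\<^sub>x s = 1 / (1 + open_loop T L \<omega>\<^sub>a \<omega>\<^sub>b \<omega>\<^sub>c l N\<^sub>m\<^sub>a\<^sub>x s)"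

text \<open>
  The improper integral over \<open>[0, \<infinity>)\<close> as a limit of proper integrals; it need not converge
  absolutely.
\<close>

definition has_improper_integral :: "(real \<Rightarrow> real) \<Rightarrow> real \<Rightarrow> bool" where
  "has_improper_integral f I \<longleftrightarrow>
     (\<forall>R\<ge>0. f integrable_on {0..R}) \<and> ((\<lambda>R. integral {0..R} f) \<longlongrightarrow> I) at_top"

lemma stage_positive:
  assumes "0 < T" "0 < \<omega>\<^sub>a"
  shows "0 < stage_period T \<omega>\<^sub>a l i" "0 < stage_cutoff T \<omega>\<^sub>a l i"
proof -
  have c: "0 < stage_ratio T \<omega>\<^sub>a l" using assms by (simp add: stage_ratio_def)
  have "0 < stage_period T \<omega>\<^sub>a l i \<and> 0 < stage_cutoff T \<omega>\<^sub>a l i"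
  proof (induction i rule: less_induct)
    case (less i)
    have p: "0 < stage_period T \<omega>\<^sub>a l i"
    proof (cases i)
      case (Suc k)
      show ?thesis
      proof (cases k)
        case (Suc m)
        then have "0 < stage_cutoff T \<omega>\<^sub>a l (Suc m)" using less \<open>i = Suc k\<close> by blast
        then show ?thesis using \<open>i = Suc k\<close> Suc by (simp del: stage_cutoff.simps)
      qed (use Suc assms in simp)
    qed (use assms in simp)
    then show ?case using c assms by simp
  qed
  then show "0 < stage_period T \<omega>\<^sub>a l i" "0 < stage_cutoff T \<omega>\<^sub>a l i" by auto
qed

lemma finite_admissible_orders: "finite (admissible_orders T L \<omega>\<^sub>a l)"
proof (rule finite_subset)
  let ?B = "(L - T) / (\<Sum>i=1..l. stage_period T \<omega>\<^sub>a l i)"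
  show "admissible_orders T L \<omega>\<^sub>a l \<subseteq> {..nat \<lfloor>?B\<rfloor>}"
    unfolding admissible_orders_def by (auto simp: le_nat_floor)
qed simp

lemma stage_peak_is_max:
  "\<exists>\<Omega>\<in>{0..pi}. stage_peak T L \<omega>\<^sub>a l N\<^sub>m\<^sub>a\<^sub>x i = stage_amplitude T L \<omega>\<^sub>a l N\<^sub>m\<^sub>a\<^sub>x i \<Omega> \<and>
     (\<forall>\<Omega>'\<in>{0..pi}. stage_amplitude T L \<omega>\<^sub>a l N\<^sub>m\<^sub>a\<^sub>x i \<Omega>' \<le> stage_amplitude T L \<omega>\<^sub>a l N\<^sub>m\<^sub>a\<^sub>x i \<Omega>)"
proof -
  let ?f = "stage_amplitude T L \<omega>\<^sub>a l N\<^sub>m\<^sub>a\<^sub>x i"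
  have "continuous_on {0..pi} ?f"
    unfolding stage_amplitude_def by (intro continuous_intros)
  then obtain x where x: "x \<in> {0..pi}" "\<forall>y\<in>{0..pi}. ?f y \<le> ?f x"
    using continuous_attains_sup[of "{0..pi}" ?f] by auto
  have "stage_peak T L \<omega>\<^sub>a l N\<^sub>m\<^sub>a\<^sub>x i = ?f x"
    unfolding stage_peak_def using x by (intro cSup_eq_maximum) auto
  then show ?thesis using x by blast
qed

end

theory Submission
  imports Defs "HOL-Complex_Analysis.Complex_Analysis" "HOL-Real_Asymp.Real_Asymp"
begin

text \<open>
  By the maximum modulus principle, applied to each stage as a polynomial in
  \<open>exp (- T U\<^sub>i s)\<close>, the low-pass filter satisfies \<open>|\<Phi> s| \<le> exp (- \<kappa> T Re s)\<close> on the right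
  half-plane. There \<open>(1 + \<Phi>) / (1 - \<Phi>)\<close> and \<open>\<omega>\<^sub>b / (s + \<omega>\<^sub>b)\<close> have positive real part, so \<open>1 + \<Gamma>\<close>
  avoids the nonpositive reals and \<open>F = Ln (1 + \<Gamma>)\<close> is holomorphic, with
  \<open>F s = K / (s + \<omega>\<^sub>b) + O(1 / |s|\<^sup>2 + exp (- \<kappa> T Re s) / |s|)\<close> for \<open>K = \<omega>\<^sub>b \<omega>\<^sub>c L / 2\<close>. Cauchy's
  theorem moves the integral of \<open>F\<close> over \<open>\<epsilon> + i[0, R]\<close> to \<open>\<surd>R + i[0, R]\<close>, where only the main term
  survives and contributes \<open>K \<pi> / 2\<close> in the limit. The value is therefore the same for every
  \<open>\<epsilon> > 0\<close>.
\<close>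

section \<open>Contour shift in the right half-plane\<close>

text \<open>The integrand is the real part of \<open>1 / (c + \<i> * \<omega>)\<close>, hence the
  main term on a vertical edge; the same formula integrates an error of size 1 / |s|^2.\<close>

lemma has_integral_vertical_reciprocal:
  fixes c R :: real
  assumes "0 < c" "0 \<le> R"
  shows "((\<lambda>\<omega>. c / (c\<^sup>2 + \<omega>\<^sup>2)) has_integral arctan (R / c)) {0..R}"
proof -
  have "((\<lambda>\<omega>. arctan (\<omega> / c)) has_real_derivative c / (c\<^sup>2 + \<omega>\<^sup>2)) (at \<omega> within {0..R})" for \<omega>
  proof -
    have "1 + (\<omega> / c)\<^sup>2 = (c\<^sup>2 + \<omega>\<^sup>2) / c\<^sup>2"
      using assms by (simp add: power_divide add_divide_distrib)
    then have "inverse (1 + (\<omega> / c)\<^sup>2) * (1 / c) = c / (c\<^sup>2 + \<omega>\<^sup>2)"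
      using assms by (simp add: power2_eq_square)
    then show ?thesis
      using assms by (auto intro!: derivative_eq_intros)
  qed
  then have "((\<lambda>\<omega>. c / (c\<^sup>2 + \<omega>\<^sup>2)) has_integral arctan (R / c) - arctan (0 / c)) {0..R}"
    using assms(2) by (intro fundamental_theorem_of_calculus)
      (auto simp: has_real_derivative_iff_has_vector_derivative)
  then show ?thesis by simp
qed

lemma norm_le_norm_add_of_real:
  fixes s :: complex
  assumes "0 \<le> Re s" "0 \<le> b"
  shows "norm s \<le> norm (s + of_real b)"
  unfolding cmod_def using assms by (simp add: power_mono)

text \<open>On the convex half-plane \<open>F\<close> has a primitive \<open>G\<close>, so Cauchy's
  theorem for the rectangle reduces to comparing \<open>Im G\<close> at the corners. The constants
  \<open>C\<close> and \<open>r\<close> may depend on \<open>\<epsilon>\<close>, as each vertical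
  line is treated on its own.\<close>

lemma half_plane_vertical_integral:
  fixes F :: "complex \<Rightarrow> complex" and K C a b \<epsilon> r :: real
  assumes hol: "F holomorphic_on {s. 0 < Re s}"
    and real: "\<And>x. 0 < x \<Longrightarrow> F (of_real x) \<in> \<real>"
    and pos: "0 < \<epsilon>" "0 < a" "0 < b" "0 \<le> C"
    and approx: "\<And>s. \<epsilon> \<le> Re s \<Longrightarrow> r \<le> norm s \<Longrightarrow>
      norm (F s - of_real K / (s + of_real b)) \<le> C / (norm s)\<^sup>2 + C * exp (- a * Re s) / norm s"
  shows "((\<lambda>R. integral {0..R} (\<lambda>\<omega>. Re (F (Complex \<epsilon> \<omega>)))) \<longlongrightarrow> K * pi / 2) at_top"
proof -
  let ?H = "{s. 0 < Re s}"
  have H: "open ?H" "convex ?H" by (auto simp: open_halfspace_Re_gt convex_halfspace_Re_gt)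
  obtain G where G: "\<And>s. s \<in> ?H \<Longrightarrow> (G has_field_derivative F s) (at s)"
    using holomorphic_convex_primitive'[OF H(2,1) hol] H(1) by (metis at_within_open)
  have prim: "(F has_contour_integral (G w - G z)) (linepath z w)" if "0 < Re z" "0 < Re w" for z w
  proof -
    have "closed_segment z w \<subseteq> ?H"
      using H(2) that by (intro closed_segment_subset) auto
    then show ?thesis
      using contour_integral_primitive[of ?H G F "linepath z w"] G
      by (auto intro: has_field_derivative_at_within)
  qed
  \<comment> \<open>Upwards ds = \<i> d\<omega>, so on a vertical line the real part of
    \<open>F\<close> integrates to an increment of \<open>Im G\<close>.\<close>
  have vert: "((\<lambda>\<omega>. Re (F (Complex c \<omega>))) has_integral Im (G (Complex c R)) - Im (G (Complex c 0))) {0..R}"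
    if "0 < c" "0 < R" for c R
  proof -
    have "((\<lambda>\<omega>. F (Complex c \<omega>)) has_integral - \<i> * (G (Complex c R) - G (Complex c 0))) {0..R}"
      using that by (intro has_contour_integral_linepath_same_Re_iff[THEN iffD1, OF _ _ _ _ _ prim]) auto
    from has_integral_Re[OF this] show ?thesis by (simp add: algebra_simps)
  qed
  \<comment> \<open>\<open>F\<close> is real on the real axis, so the bottom edge is invisible to the imaginary part.\<close>
  have bottom: "Im (G (Complex X 0)) = Im (G (Complex \<epsilon> 0))" if "\<epsilon> < X" for X
  proof -
    have "((\<lambda>x. F (of_real x)) has_integral G (of_real X) - G (of_real \<epsilon>)) {\<epsilon>..X}"
      using has_contour_integral_linepath_Reals_iff[of "of_real \<epsilon>" "of_real X"]
        prim[of "of_real \<epsilon>" "of_real X"] that pos by auto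
    from has_integral_Im[OF this] have "((\<lambda>x. 0) has_integral Im (G (of_real X) - G (of_real \<epsilon>))) {\<epsilon>..X}"
      by (rule has_integral_eq[rotated]) (use real pos in \<open>auto simp: complex_is_Real_iff\<close>)
    then have "Im (G (of_real X) - G (of_real \<epsilon>)) = 0"
      using has_integral_0 has_integral_unique by blast
    then show ?thesis by (simp add: complex_of_real_def)
  qed
  \<comment> \<open>For \<open>norm s\<close> at least 1 each error term is at most
    \<open>C / norm s\<close>, and the main term is at most
    \<open>\<bar>K\<bar> / norm s\<close>.\<close>
  define M where "M = \<bar>K\<bar> + 2 * C"
  have M: "0 \<le> M" using pos by (simp add: M_def)
  have decay: "norm (F s) \<le> M / norm s" if s: "\<epsilon> \<le> Re s" "r \<le> norm s" "1 \<le> norm s" for s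
  proof -
    have "norm s \<le> norm (s + of_real b)"
      using s pos by (intro norm_le_norm_add_of_real) auto
    then have 1: "norm (of_real K / (s + of_real b)) \<le> \<bar>K\<bar> / norm s"
      unfolding norm_divide norm_of_real using s by (intro divide_left_mono mult_pos_pos) auto
    have "C / (norm s)\<^sup>2 \<le> C / norm s"
      using s pos self_le_power[of "norm s" 2]
      by (intro divide_left_mono mult_pos_pos zero_less_power) auto
    moreover have "C * exp (- a * Re s) / norm s \<le> C * 1 / norm s"
      using s pos by (intro divide_right_mono mult_left_mono) auto
    ultimately have "norm (F s - of_real K / (s + of_real b)) \<le> 2 * C / norm s"
      using approx[OF s(1,2)] by (simp add: add_divide_distrib)
    with 1 show ?thesis
      using norm_triangle_sub[of "F s" "of_real K / (s + of_real b)"]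
      by (simp add: M_def add_divide_distrib)
  qed
  \<comment> \<open>On this edge \<open>norm s\<close> is at least \<open>R\<close>, and the length
    of the edge is less than \<open>X\<close>.\<close>
  have top: "\<bar>Im (G (Complex X R)) - Im (G (Complex \<epsilon> R))\<bar> \<le> M / R * X"
    if "\<epsilon> < X" "r \<le> R" "1 \<le> R" for X R
  proof -
    have "norm (G (Complex X R) - G (Complex \<epsilon> R)) \<le> M / R * norm (Complex X R - Complex \<epsilon> R)"
    proof (rule has_contour_integral_bound_linepath[OF prim])
      fix s assume s: "s \<in> closed_segment (Complex \<epsilon> R) (Complex X R)"
      have "Im s = R" "\<epsilon> \<le> Re s"
        using s that by (auto simp: closed_segment_same_Im closed_segment_eq_real_ivl)
      moreover from this have "R \<le> norm s" using abs_Im_le_cmod[of s] by simp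
      ultimately have "norm (F s) \<le> M / norm s" using that by (intro decay) auto
      also have "\<dots> \<le> M / R" using \<open>R \<le> norm s\<close> that M
        by (intro divide_left_mono mult_pos_pos) auto
      finally show "norm (F s) \<le> M / R" .
    qed (use that pos M in auto)
    also have "\<dots> \<le> M / R * X"
      using that pos M by (intro mult_left_mono) (simp_all add: complex_diff cmod_def)
    finally have "norm (G (Complex X R) - G (Complex \<epsilon> R)) \<le> M / R * X" .
    then show ?thesis using abs_Im_le_cmod[of "G (Complex X R) - G (Complex \<epsilon> R)"] by simp
  qed
  \<comment> \<open>The main term and the quadratic error integrate to arctangents; the exponential
    error is bounded by a constant on the edge, whence the factor \<open>R\<close>.\<close>
  have right: "\<bar>Im (G (Complex X R)) - Im (G (Complex X 0)) - K * arctan (R / (X + b))\<bar>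
      \<le> C / X * arctan (R / X) + C * exp (- a * X) / X * R"
    if "\<epsilon> < X" "r \<le> X" "0 < R" for X R
  proof -
    have X: "0 < X" using that pos by simp
    let ?f = "\<lambda>\<omega>. Re (F (Complex X \<omega>)) - K * ((X + b) / ((X + b)\<^sup>2 + \<omega>\<^sup>2))"
    let ?g = "\<lambda>\<omega>. C / X * (X / (X\<^sup>2 + \<omega>\<^sup>2)) + C * exp (- a * X) / X"
    have f: "(?f has_integral (Im (G (Complex X R)) - Im (G (Complex X 0)) - K * arctan (R / (X + b)))) {0..R}"
      using X pos that
      by (intro has_integral_diff vert has_integral_mult_right has_integral_vertical_reciprocal) auto
    have g: "(?g has_integral (C / X * arctan (R / X) + C * exp (- a * X) / X * R)) {0..R}"
      using has_integral_const_real[of "C * exp (- a * X) / X" 0 R] X that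
      by (intro has_integral_add has_integral_mult_right has_integral_vertical_reciprocal)
        (auto simp: mult.commute)
    have le: "norm (?f \<omega>) \<le> ?g \<omega>" for \<omega>
    proof -
      let ?s = "Complex X \<omega>"
      have n: "X \<le> norm ?s" "(norm ?s)\<^sup>2 = X\<^sup>2 + \<omega>\<^sup>2"
        using abs_Re_le_cmod[of ?s] by (auto simp: cmod_power2)
      have "?f \<omega> = Re (F ?s - of_real K / (?s + of_real b))"
        by (simp add: Re_divide power2_eq_square)
      also have "\<bar>\<dots>\<bar> \<le> norm (F ?s - of_real K / (?s + of_real b))" by (rule abs_Re_le_cmod)
      also have "\<dots> \<le> C / (norm ?s)\<^sup>2 + C * exp (- a * Re ?s) / norm ?s"
        using that n by (intro approx) auto
      also have "\<dots> \<le> C / (X\<^sup>2 + \<omega>\<^sup>2) + C * exp (- a * X) / X"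
        unfolding n(2) complex.sel using n X pos
        by (intro add_mono divide_left_mono mult_pos_pos) (auto intro: add_pos_nonneg)
      finally show ?thesis using X by simp
    qed
    show ?thesis
      using integral_norm_bound_integral[of ?f "{0..R}" ?g] f g le
      by (simp add: has_integral_iff)
  qed
  \<comment> \<open>The right edge \<open>X = \<surd>R\<close> makes the top edge, of size \<open>X / R\<close>, and the exponential error
    \<open>R exp (- a X) / X\<close> vanish together.\<close>
  let ?V = "\<lambda>R. integral {0..R} (\<lambda>\<omega>. Re (F (Complex \<epsilon> \<omega>)))"
  let ?E = "\<lambda>R. M / R * sqrt R + (C / sqrt R * arctan (R / sqrt R) + C * exp (- a * sqrt R) / sqrt R * R)"
  have "\<forall>\<^sub>F R in at_top. norm (?V R - K * arctan (R / (sqrt R + b))) \<le> ?E R"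
  proof -
    have "\<forall>\<^sub>F R in at_top. \<epsilon> < sqrt R \<and> r < sqrt R \<and> r \<le> R \<and> 1 \<le> R"
      using filterlim_at_top_dense[THEN iffD1, OF sqrt_at_top]
      by (intro eventually_conj eventually_ge_at_top) auto
    then show ?thesis
    proof eventually_elim
      case (elim R)
      have "?V R = Im (G (Complex \<epsilon> R)) - Im (G (Complex \<epsilon> 0))"
        using vert[of \<epsilon> R] pos elim by (simp add: has_integral_iff)
      then show ?case
        using top[of "sqrt R" R] right[of "sqrt R" R] bottom[of "sqrt R"] elim by simp
    qed
  qed
  moreover have "(?E \<longlongrightarrow> 0) at_top" using pos by real_asymp
  ultimately have "((\<lambda>R. ?V R - K * arctan (R / (sqrt R + b))) \<longlongrightarrow> 0) at_top"
    by (rule Lim_null_comparison)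
  moreover have "((\<lambda>R. K * arctan (R / (sqrt R + b))) \<longlongrightarrow> K * (pi / 2)) at_top"
    by (intro tendsto_mult tendsto_const) real_asymp
  ultimately have "((\<lambda>R. (?V R - K * arctan (R / (sqrt R + b))) + K * arctan (R / (sqrt R + b)))
      \<longlongrightarrow> 0 + K * (pi / 2)) at_top"
    by (rule tendsto_add)
  then show ?thesis by simp
qed

section \<open>Logarithm of the sensitivity\<close>

text \<open>Both arguments lie strictly between -\<pi>/2 and \<pi>/2, so the product is never a
  negative real. The proof expresses this in coordinates.\<close>

lemma one_plus_mult_notin_nonpos_Reals:
  fixes w v :: complex
  assumes "0 < Re w" "0 < Re v"
  shows "1 + w * v \<notin> \<real>\<^sub>\<le>\<^sub>0"
proof
  assume "1 + w * v \<in> \<real>\<^sub>\<le>\<^sub>0"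
  then have "Re (w * v) < 0" "Im (w * v) = 0" by (auto simp: complex_nonpos_Reals_iff)
  then have lt: "Re w * Re v < Im w * Im v" and eq: "Im w * Re v = - (Re w * Im v)" by auto
  \<comment> \<open>Multiplying by \<open>Re v\<close> allows \<open>Im w\<close> to be eliminated,
    which leaves \<open>Re w\<close> times |v|^2 negative.\<close>
  have "Re w * Re v * Re v < Im w * Im v * Re v"
    using lt assms by (intro mult_strict_right_mono)
  also have "\<dots> = - (Re w * Im v * Im v)" using eq by algebra
  finally have "Re w * ((Re v)\<^sup>2 + (Im v)\<^sup>2) < 0"
    by (simp add: algebra_simps power2_eq_square)
  moreover have "0 \<le> Re w * ((Re v)\<^sup>2 + (Im v)\<^sup>2)" using assms by simp
  ultimately show False by simp
qed

text \<open>The real part equals (1 - |z|^2) / |1 - z|^2.\<close>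

lemma Re_Cayley_pos:
  fixes z :: complex
  assumes "norm z < 1"
  shows "0 < Re ((1 + z) / (1 - z))"
proof -
  have "z \<noteq> 1" using assms by auto
  then have "0 < (norm (1 - z))\<^sup>2" by simp
  then have "0 < (Re (1 - z))\<^sup>2 + (Im (1 - z))\<^sup>2" by (simp only: cmod_power2)
  moreover have "(norm z)\<^sup>2 < 1" using assms by (simp add: abs_square_less_1)
  then have "(Re z)\<^sup>2 + (Im z)\<^sup>2 < 1" by (simp only: cmod_power2)
  then have "0 < Re (1 + z) * Re (1 - z) + Im (1 + z) * Im (1 - z)"
    by (simp add: algebra_simps power2_eq_square)
  ultimately show ?thesis unfolding Re_divide by simp
qed

text \<open>The log sensitivity is minus the real part of \<open>Ln (1 + \<Gamma>)\<close>, to which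
  the contour shift applies with \<open>K = A * b\<close>. The filter enters only through
  holomorphy, realness on the real axis and decay in \<open>Re s\<close>.\<close>

lemma log_sensitivity_improper_integral:
  fixes \<Phi> :: "complex \<Rightarrow> complex" and A a b \<epsilon> :: real
  assumes hol: "\<Phi> holomorphic_on {s. 0 < Re s}"
    and real: "\<And>x. \<Phi> (of_real x) \<in> \<real>"
    and le: "\<And>s. 0 < Re s \<Longrightarrow> norm (\<Phi> s) \<le> exp (- a * Re s)"
    and pos: "0 < A" "0 < a" "0 < b" "0 < \<epsilon>"
  defines "\<Gamma> \<equiv> \<lambda>s. of_real A * ((1 + \<Phi> s) / (1 - \<Phi> s)) * (of_real b / (s + of_real b))"
  shows "has_improper_integral (\<lambda>\<omega>. ln (norm (1 / (1 + \<Gamma> (Complex \<epsilon> \<omega>))))) (- (A * b * pi / 2))"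
proof -
  let ?H = "{s. 0 < Re s}"
  have lt1: "norm (\<Phi> s) < 1" if "0 < Re s" for s
  proof -
    have "exp (- a * Re s) < 1" using that pos by simp
    then show ?thesis using le[OF that] by linarith
  qed
  have nz: "\<Phi> s \<noteq> 1" "s + of_real b \<noteq> 0" if "0 < Re s" for s
    using lt1[OF that] that pos by (auto dest: arg_cong[where f = Re])
  have cut: "1 + \<Gamma> s \<notin> \<real>\<^sub>\<le>\<^sub>0" if s: "0 < Re s" for s
  proof -
    have "0 < Re (of_real A * ((1 + \<Phi> s) / (1 - \<Phi> s)))"
      unfolding times_complex.sel Re_complex_of_real Im_complex_of_real
      using Re_Cayley_pos[OF lt1[OF s]] pos by simp
    moreover have "0 < Re (of_real b / (s + of_real b))"
      using s pos nz(2)[OF s] by (auto simp: Re_divide complex_eq_iff intro!: divide_pos_pos add_pos_nonneg)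
    ultimately show ?thesis unfolding \<Gamma>_def by (rule one_plus_mult_notin_nonpos_Reals)
  qed
  define F where "F = (\<lambda>s. Ln (1 + \<Gamma> s))"
  have holF: "F holomorphic_on ?H"
    unfolding F_def
    by (rule holomorphic_on_Ln'; (use cut in blast)?)
      (auto simp: \<Gamma>_def nz intro!: holomorphic_intros hol)
  have lnF: "ln (norm (1 / (1 + \<Gamma> s))) = - Re (F s)" if "0 < Re s" for s
    using cut[OF that] by (auto simp: F_def norm_divide ln_div)
  \<comment> \<open>For \<open>Re s\<close> at least \<open>\<epsilon>\<close> the denominator
    \<open>1 - \<Phi> s\<close> stays at least \<open>1 - exp (- a * \<epsilon>)\<close> in
    norm.\<close>
  define M where "M = 2 * A * b / (1 - exp (- a * \<epsilon>))"
  have d: "exp (- a * \<epsilon>) < 1" using pos by simp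
  have M: "0 < M" unfolding M_def using d pos by simp
  \<comment> \<open>The threshold \<open>2 * M\<close> forces |\<Gamma>| \<le> 1/2, so the linear
    approximation of \<open>Ln\<close> costs at most 2 M^2 / |s|^2; \<open>C\<close> dominates this
    constant and the \<open>M\<close> of the exponential error.\<close>
  have lim: "((\<lambda>R. integral {0..R} (\<lambda>\<omega>. Re (F (Complex \<epsilon> \<omega>)))) \<longlongrightarrow> (A * b) * pi / 2) at_top"
  proof (rule half_plane_vertical_integral[OF holF, where a = a and b = b and C = "M + 2 * M\<^sup>2" and r = "2 * M"])
    fix x :: real assume x: "0 < x"
    have "\<Gamma> (of_real x) \<in> \<real>" unfolding \<Gamma>_def by (intro Reals_mult Reals_divide Reals_add Reals_diff real) auto
    then have "1 + \<Gamma> (of_real x) \<in> \<real>" by simp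
    then obtain y where y: "1 + \<Gamma> (of_real x) = of_real y" by (rule Reals_cases)
    \<comment> \<open>A real number off the branch cut is positive, so its principal logarithm is
      real.\<close>
    then have "0 < y" using cut[of "of_real x"] x by (simp add: complex_nonpos_Reals_iff)
    then show "F (of_real x) \<in> \<real>" by (simp add: F_def y Ln_of_real)
  next
    fix s assume s: "\<epsilon> \<le> Re s" "2 * M \<le> norm s"
    have Re: "0 < Re s" using s pos by simp
    have ns: "0 < norm s" using s M by linarith
    have "norm (\<Phi> s) \<le> exp (- a * \<epsilon>)"
      using le[OF Re] s pos by (smt (verit) exp_le_cancel_iff mult_left_mono mult_minus_left)
    then have den: "1 - exp (- a * \<epsilon>) \<le> norm (1 - \<Phi> s)"
      using norm_triangle_ineq2[of 1 "\<Phi> s"] by simp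
    have sb: "norm s \<le> norm (s + of_real b)"
      using Re pos by (intro norm_le_norm_add_of_real) auto
    \<comment> \<open>Used twice: \<open>z = \<Phi> s\<close> gives the error of the main term,
      \<open>z = (1 + \<Phi> s) / 2\<close> gives the size of \<open>\<Gamma> s\<close>.\<close>
    have frac: "norm (2 * of_real A * of_real b * z / ((1 - \<Phi> s) * (s + of_real b))) \<le> M * norm z / norm s" for z
    proof -
      have "norm (2 * of_real A * of_real b * z / ((1 - \<Phi> s) * (s + of_real b)))
          = 2 * A * b * norm z / (norm (1 - \<Phi> s) * norm (s + of_real b))"
        using pos by (simp add: norm_mult norm_divide)
      also have "\<dots> \<le> 2 * A * b * norm z / ((1 - exp (- a * \<epsilon>)) * norm s)"
      proof (intro divide_left_mono mult_mono mult_pos_pos)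
        show "0 < norm (1 - \<Phi> s)" "0 < norm (s + of_real b)" using d den ns sb by linarith+
      qed (use pos d ns den sb in \<open>simp_all add: less_imp_le\<close>)
      finally show ?thesis by (simp add: M_def)
    qed
    have cayley: "(1 + \<Phi> s) / (1 - \<Phi> s) = 1 + 2 * \<Phi> s / (1 - \<Phi> s)"
      using nz(1)[OF Re] by (simp add: field_simps)
    have "\<Gamma> s - of_real (A * b) / (s + of_real b)
        = 2 * of_real A * of_real b * \<Phi> s / ((1 - \<Phi> s) * (s + of_real b))"
      unfolding \<Gamma>_def cayley distrib_left distrib_right
      by (simp add: mult_ac) (simp add: algebra_simps)
    then have "norm (\<Gamma> s - of_real (A * b) / (s + of_real b)) \<le> M * norm (\<Phi> s) / norm s"
      using frac by simp
    also have "\<dots> \<le> M * exp (- a * Re s) / norm s"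
      using le[OF Re] M by (intro divide_right_mono mult_left_mono) auto
    finally have 1: "norm (\<Gamma> s - of_real (A * b) / (s + of_real b)) \<le> M * exp (- a * Re s) / norm s" .
    have "\<Gamma> s = 2 * of_real A * of_real b * ((1 + \<Phi> s) / 2) / ((1 - \<Phi> s) * (s + of_real b))"
      by (simp add: \<Gamma>_def)
    then have "norm (\<Gamma> s) \<le> M * norm ((1 + \<Phi> s) / 2) / norm s"
      by (simp only: frac)
    also have "\<dots> \<le> M * 1 / norm s"
      using lt1[OF Re] norm_triangle_ineq[of 1 "\<Phi> s"] M
      by (intro divide_right_mono mult_left_mono) (auto simp: norm_divide)
    finally have g: "norm (\<Gamma> s) \<le> M / norm s" by simp
    also have "\<dots> \<le> 1 / 2" using s ns by (simp add: field_simps)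
    finally have half: "norm (\<Gamma> s) \<le> 1 / 2" .
    have "norm (F s - \<Gamma> s) \<le> (norm (\<Gamma> s))\<^sup>2 / (1 - norm (\<Gamma> s))"
      unfolding F_def using half by (intro Ln_approx_linear) auto
    also have "\<dots> \<le> (M / norm s)\<^sup>2 / (1 / 2)"
      using g half by (intro frac_le power_mono) auto
    finally have 2: "norm (F s - \<Gamma> s) \<le> 2 * M\<^sup>2 / (norm s)\<^sup>2" by (simp add: power_divide mult.commute)
    have "norm (F s - of_real (A * b) / (s + of_real b)) \<le> 2 * M\<^sup>2 / (norm s)\<^sup>2 + M * exp (- a * Re s) / norm s"
      using 1 2 norm_triangle_ineq[of "F s - \<Gamma> s" "\<Gamma> s - of_real (A * b) / (s + of_real b)"] by simp
    also have "\<dots> \<le> (M + 2 * M\<^sup>2) / (norm s)\<^sup>2 + (M + 2 * M\<^sup>2) * exp (- a * Re s) / norm s"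
      using M by (intro add_mono divide_right_mono mult_right_mono) auto
    finally show "norm (F s - of_real (A * b) / (s + of_real b))
        \<le> (M + 2 * M\<^sup>2) / (norm s)\<^sup>2 + (M + 2 * M\<^sup>2) * exp (- a * Re s) / norm s" .
  qed (use pos M in auto)
  have int: "(\<lambda>\<omega>. Re (F (Complex \<epsilon> \<omega>))) integrable_on {0..R}" for R
  proof (rule integrable_continuous_real)
    have "continuous_on {0..R} (\<lambda>\<omega>. F (Complex \<epsilon> \<omega>))"
      unfolding Complex_eq
      by (rule continuous_on_compose2[OF holomorphic_on_imp_continuous_on[OF holF]])
        (auto intro!: continuous_intros simp: pos)
    then show "continuous_on {0..R} (\<lambda>\<omega>. Re (F (Complex \<epsilon> \<omega>)))" by (intro continuous_intros)
  qed
  have eq: "(\<lambda>\<omega>. ln (norm (1 / (1 + \<Gamma> (Complex \<epsilon> \<omega>))))) = (\<lambda>\<omega>. - Re (F (Complex \<epsilon> \<omega>)))"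
    using lnF pos by auto
  show ?thesis
    unfolding has_improper_integral_def eq integral_neg
    using int lim by (auto intro: integrable_neg tendsto_minus)
qed

section \<open>Modulus bounds for the low-pass filter\<close>

lemma sum_symmetric_int_interval:
  fixes f :: "int \<Rightarrow> 'a :: comm_monoid_add"
  shows "(\<Sum>n=-int N..int N. f n) = f 0 + (\<Sum>n=1..N. f (int n) + f (- int n))"
proof (induction N)
  case (Suc N)
  have "{- int (Suc N)..int (Suc N)} = insert (int (Suc N)) (insert (- int (Suc N)) {-int N..int N})"
    by auto
  then show ?case using Suc by (simp add: ac_simps)
qed simp

text \<open>The window is built from cosines and the ideal response is a quotient of odd functions.
  This symmetry is the source of the linear phase.\<close>

lemma stage_coeff_minus: "stage_coeff T L \<omega>\<^sub>a l N\<^sub>m\<^sub>a\<^sub>x i (- n) = stage_coeff T L \<omega>\<^sub>a l N\<^sub>m\<^sub>a\<^sub>x i n"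
  unfolding stage_coeff_def blackman_window_def ideal_response_def by (auto simp del: stage_cutoff.simps)

text \<open>On the unit circle the modulus is the stage amplitude at some angle, hence at most the
  peak; the maximum modulus principle extends the bound to the disc.\<close>

lemma norm_stage_polynomial_le:
  fixes z :: complex and T L \<omega>\<^sub>a :: real and l N\<^sub>m\<^sub>a\<^sub>x i :: nat
  assumes "norm z \<le> 1"
  defines "N \<equiv> filter_order T L \<omega>\<^sub>a l N\<^sub>m\<^sub>a\<^sub>x"
  shows "norm (\<Sum>n=-int N..int N. of_real (stage_coeff T L \<omega>\<^sub>a l N\<^sub>m\<^sub>a\<^sub>x i n) * z ^ nat (int N - n))
    \<le> stage_peak T L \<omega>\<^sub>a l N\<^sub>m\<^sub>a\<^sub>x i" (is "norm (?p z) \<le> ?\<gamma>")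
proof -
  let ?c = "stage_coeff T L \<omega>\<^sub>a l N\<^sub>m\<^sub>a\<^sub>x i"
  have circle: "norm (?p u) \<le> ?\<gamma>" if u: "norm u = 1" for u
  proof -
    define \<theta> where "\<theta> = Arg u"
    have "u \<noteq> 0" using u by auto
    then have u_eq: "u = cis \<theta>" using u by (simp add: \<theta>_def cis_Arg sgn_div_norm)
    have pow: "u ^ nat (int N - n) = cis (N * \<theta>) * cis (- (of_int n * \<theta>))" if "n \<le> int N" for n
    proof -
      have "real (nat (int N - n)) * \<theta> = N * \<theta> + - (of_int n * \<theta>)"
        using that by (simp add: algebra_simps)
      then show ?thesis unfolding u_eq Complex.DeMoivre cis_mult by (rule arg_cong)
    qed
    \<comment> \<open>The unimodular delay \<open>cis (N * \<theta>)\<close> factors out.\<close>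
    have "?p u = (\<Sum>n=-int N..int N. cis (N * \<theta>) * (of_real (?c n) * cis (- (of_int n * \<theta>))))"
      by (intro sum.cong refl) (simp add: pow)
    also have "\<dots> = cis (N * \<theta>) * (\<Sum>n=-int N..int N. of_real (?c n) * cis (- (of_int n * \<theta>)))"
      by (simp add: sum_distrib_left)
    finally have "norm (?p u) = norm (\<Sum>n=-int N..int N. of_real (?c n) * cis (- (of_int n * \<theta>)))"
      by (simp add: norm_mult)
    \<comment> \<open>Pairing n with -n leaves a real cosine sum. It is even in
      \<open>\<theta>\<close>, so \<open>\<bar>\<theta>\<bar>\<close> may be used, which lies in the
      range of the supremum.\<close>
    also have "(\<Sum>n=-int N..int N. of_real (?c n) * cis (- (of_int n * \<theta>)))
        = of_real (?c 0 + 2 * (\<Sum>n=1..N. ?c (int n) * cos (real n * \<bar>\<theta>\<bar>)))"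
    proof -
      have "of_real (?c (int n)) * cis (- (of_int (int n) * \<theta>)) + of_real (?c (- int n)) * cis (- (of_int (- int n) * \<theta>))
          = of_real (2 * (?c (int n) * cos (real n * \<bar>\<theta>\<bar>)))" for n
        by (cases "0 \<le> \<theta>") (simp_all add: stage_coeff_minus complex_eq_iff)
      then show ?thesis
        unfolding sum_symmetric_int_interval by (simp add: sum_distrib_left)
    qed
    also have "norm \<dots> = stage_amplitude T L \<omega>\<^sub>a l N\<^sub>m\<^sub>a\<^sub>x i \<bar>\<theta>\<bar>"
      unfolding norm_of_real by (simp add: stage_amplitude_def N_def)
    also have "\<dots> \<le> ?\<gamma>"
    proof -
      have "\<bar>\<theta>\<bar> \<in> {0..pi}" using Arg_bounded[of u] by (auto simp: \<theta>_def)
      then show ?thesis using stage_peak_is_max[of T L \<omega>\<^sub>a l N\<^sub>m\<^sub>a\<^sub>x i] by metis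
    qed
    finally show ?thesis .
  qed
  have hol: "?p holomorphic_on S" for S by (intro holomorphic_intros)
  show ?thesis
    by (rule maximum_modulus_frontier[where S = "cball 0 1"])
      (use assms circle hol holomorphic_on_imp_continuous_on[OF hol] in auto)
qed

text \<open>The stage is the polynomial above, divided by its peak, at a point \<open>z\<close> of
  the closed unit disc.\<close>

lemma norm_stage_filter_le_1:
  assumes "0 < T" "0 < \<omega>\<^sub>a" "0 \<le> Re s"
  shows "norm (stage_filter T L \<omega>\<^sub>a l N\<^sub>m\<^sub>a\<^sub>x i s) \<le> 1"
proof -
  define N where "N = filter_order T L \<omega>\<^sub>a l N\<^sub>m\<^sub>a\<^sub>x"
  define U where "U = stage_steps T \<omega>\<^sub>a l i"
  define z where "z = exp (- (of_real T * of_int U * s))"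
  let ?c = "stage_coeff T L \<omega>\<^sub>a l N\<^sub>m\<^sub>a\<^sub>x i" and ?\<gamma> = "stage_peak T L \<omega>\<^sub>a l N\<^sub>m\<^sub>a\<^sub>x i"
  \<comment> \<open>Rounding is monotone, so \<open>U\<close> is nonnegative and \<open>z\<close>
    lies in the disc.\<close>
  have "round (0::real) \<le> U" unfolding U_def stage_steps_def
    using stage_positive(1)[OF assms(1,2), of l i] assms by (intro round_mono) simp
  then have z: "norm z \<le> 1" using assms by (simp add: z_def)
  have pow: "exp (of_int (n - int N) * of_real T * of_int U * s) = z ^ nat (int N - n)" if "n \<le> int N" for n
    using that by (simp add: z_def exp_of_nat_mult[symmetric] algebra_simps)
  have "stage_filter T L \<omega>\<^sub>a l N\<^sub>m\<^sub>a\<^sub>x i s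
      = 1 / of_real ?\<gamma> * (\<Sum>n=-int N..int N. of_real (?c n) * exp (of_int (n - int N) * of_real T * of_int U * s))"
    by (simp add: stage_filter_def N_def U_def Let_def)
  also have "\<dots> = 1 / of_real ?\<gamma> * (\<Sum>n=-int N..int N. of_real (?c n) * z ^ nat (int N - n))"
    by (intro arg_cong2[where f = "(*)"] sum.cong refl pow) simp
  finally have "norm (stage_filter T L \<omega>\<^sub>a l N\<^sub>m\<^sub>a\<^sub>x i s)
      = norm (\<Sum>n=-int N..int N. of_real (?c n) * z ^ nat (int N - n)) / \<bar>?\<gamma>\<bar>"
    by (simp add: norm_mult norm_divide)
  moreover have le: "norm (\<Sum>n=-int N..int N. of_real (?c n) * z ^ nat (int N - n)) \<le> ?\<gamma>"
    unfolding N_def by (rule norm_stage_polynomial_le[OF z])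
  moreover from le have "0 \<le> ?\<gamma>" by (rule order_trans[OF norm_ge_zero])
  \<comment> \<open>If the peak is 0, division by zero makes the stage 0 and the bound still
    holds.\<close>
  ultimately show ?thesis by (cases "?\<gamma> = 0") (simp_all add: divide_le_eq_1)
qed

text \<open>The residual delay supplies the whole exponential factor; the stages have modulus at
  most 1.\<close>

lemma norm_lowpass_filter_le:
  assumes "0 < T" "0 < \<omega>\<^sub>a" "0 \<le> Re s"
  shows "norm (lowpass_filter T L \<omega>\<^sub>a l N\<^sub>m\<^sub>a\<^sub>x s)
    \<le> exp (- (of_int (residual_delay T L \<omega>\<^sub>a l N\<^sub>m\<^sub>a\<^sub>x) * T) * Re s)"
    (is "_ \<le> exp (- (of_int ?\<kappa> * T) * Re s)")
proof -
  have "(\<Prod>i=1..l. norm (stage_filter T L \<omega>\<^sub>a l N\<^sub>m\<^sub>a\<^sub>x i s)) \<le> 1"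
    using norm_stage_filter_le_1[OF assms] by (intro prod_le_1) auto
  then have "exp (- (of_int ?\<kappa> * T) * Re s) * (\<Prod>i=1..l. norm (stage_filter T L \<omega>\<^sub>a l N\<^sub>m\<^sub>a\<^sub>x i s))
      \<le> exp (- (of_int ?\<kappa> * T) * Re s) * 1"
    by (intro mult_left_mono) simp_all
  then show ?thesis
    by (simp add: lowpass_filter_def norm_mult prod_norm)
qed

lemma holomorphic_lowpass_filter: "lowpass_filter T L \<omega>\<^sub>a l N\<^sub>m\<^sub>a\<^sub>x holomorphic_on S"
  unfolding lowpass_filter_def stage_filter_def Let_def by (intro holomorphic_intros)

lemma lowpass_filter_real: "lowpass_filter T L \<omega>\<^sub>a l N\<^sub>m\<^sub>a\<^sub>x (of_real x) \<in> \<real>"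
  unfolding lowpass_filter_def stage_filter_def Let_def
  by (intro Reals_mult prod_in_Reals Reals_divide sum_in_Reals exp_in_Reals Reals_minus) auto

section \<open>The integral for the concrete loop\<close>

theorem theorem6:
  fixes T L \<omega>\<^sub>a \<omega>\<^sub>b \<omega>\<^sub>c \<rho> :: real and l N\<^sub>m\<^sub>a\<^sub>x :: nat
  assumes "0 < T" and "0 < L" and "0 < \<omega>\<^sub>a" and "0 < \<omega>\<^sub>b"
    and "0 < l" and "0 < N\<^sub>m\<^sub>a\<^sub>x"
    and "\<rho> \<in> {0..<pi / L}"
    and "\<omega>\<^sub>c = 2 / L * tan (L / 2 * \<rho>)" and "0 < \<omega>\<^sub>c"
    and "admissible_orders T L \<omega>\<^sub>a l \<noteq> {}"
    and "1 \<le> residual_delay T L \<omega>\<^sub>a l N\<^sub>m\<^sub>a\<^sub>x"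
  shows "\<exists>I. (\<forall>\<^sub>F \<epsilon> in at_right 0. has_improper_integral
               (\<lambda>\<omega>. ln (norm (sensitivity T L \<omega>\<^sub>a \<omega>\<^sub>b \<omega>\<^sub>c l N\<^sub>m\<^sub>a\<^sub>x (of_real \<epsilon> + \<i> * of_real \<omega>)))) (I \<epsilon>)) \<and>
             (I \<longlongrightarrow> - (pi * \<omega>\<^sub>b * \<omega>\<^sub>c * L / 4)) (at_right 0)"
proof (intro exI conjI)
  let ?J = "- (pi * \<omega>\<^sub>b * \<omega>\<^sub>c * L / 4)"
  let ?\<Phi> = "lowpass_filter T L \<omega>\<^sub>a l N\<^sub>m\<^sub>a\<^sub>x"
  let ?a = "of_int (residual_delay T L \<omega>\<^sub>a l N\<^sub>m\<^sub>a\<^sub>x) * T"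
  \<comment> \<open>This fixes the witness as a constant function: every positive
    \<open>\<epsilon>\<close> gives the same integral, so the limit is trivial.\<close>
  show "\<forall>\<^sub>F \<epsilon> in at_right 0. has_improper_integral
      (\<lambda>\<omega>. ln (norm (sensitivity T L \<omega>\<^sub>a \<omega>\<^sub>b \<omega>\<^sub>c l N\<^sub>m\<^sub>a\<^sub>x (of_real \<epsilon> + \<i> * of_real \<omega>)))) ?J"
    using eventually_at_right_less[of 0]
  proof eventually_elim
    case (elim \<epsilon>)
    have "has_improper_integral (\<lambda>\<omega>. ln (norm (1 / (1 + of_real (\<omega>\<^sub>c * L / 2) *
        ((1 + ?\<Phi> (Complex \<epsilon> \<omega>)) / (1 - ?\<Phi> (Complex \<epsilon> \<omega>))) *
        (of_real \<omega>\<^sub>b / (Complex \<epsilon> \<omega> + of_real \<omega>\<^sub>b)))))) (- ((\<omega>\<^sub>c * L / 2) * \<omega>\<^sub>b * pi / 2))"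
      using assms(1-4,9,11) elim
      by (intro log_sensitivity_improper_integral[where a = ?a] holomorphic_lowpass_filter
          lowpass_filter_real norm_lowpass_filter_le) auto
    then show ?case
      by (simp add: sensitivity_def open_loop_def Complex_eq mult_ac)
  qed
  show "((\<lambda>_. ?J) \<longlongrightarrow> ?J) (at_right 0)" by (rule tendsto_const)
qed

end
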